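(* Let $\epsilon>0$ be fixed and let $g:\{1,2,3,\dots\}\to\{0,1,2,\dots\}$ be a function with $g(n)=O(n^{2-2\epsilon})$ as $n\to\infty$. For each integer $n\ge 2$ let $a,b$ be independent random variables, each uniformly distributed on $\{1,2,\dots,n\}$, let $A$ be the end point of a simple symmetric random walk on $\mathbb{Z}$ with $g(n)$ steps started at $a$, and let $B$ be the end point of a simple symmetric random walk on $\mathbb{Z}$ with $g(n)$ steps started at $b$, where the steps of the two walks are independent of each other and of $(a,b)$. Then $$\lim_{n\to\infty} P(a<b \mid A<B)=1 .$$
   Context: A simple symmetric random walk on $\mathbb{Z}$ with $m$ steps started at $x$ has end point $x+X_1+\cdots+X_m$, where $X_1,\dots,X_m$ are independent and each $X_i$ equals $1$ or $-1$ with probability $1/2$ each. *)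

theory Defs
  imports "HOL-Probability.Probability" "HOL-Library.Landau_Symbols"
begin

definition walk_endpoint :: "('w \<Rightarrow> int) \<Rightarrow> (nat \<Rightarrow> 'w \<Rightarrow> int) \<Rightarrow> nat \<Rightarrow> 'w \<Rightarrow> int" where
  "walk_endpoint x X m \<omega> = x \<omega> + (\<Sum>i=1..m. X i \<omega>)"

datatype walk_index = Start_A | Start_B | Step_A nat | Step_B nat

primrec walk_family ::
  "('w \<Rightarrow> int) \<Rightarrow> ('w \<Rightarrow> int) \<Rightarrow> (nat \<Rightarrow> 'w \<Rightarrow> int) \<Rightarrow> (nat \<Rightarrow> 'w \<Rightarrow> int) \<Rightarrow> walk_index \<Rightarrow> 'w \<Rightarrow> int"
where
  "walk_family a b X Y Start_A = a"
| "walk_family a b X Y Start_B = b"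
| "walk_family a b X Y (Step_A i) = X i"
| "walk_family a b X Y (Step_B i) = Y i"

text \<open>
  The steps are \<open>X i\<close> and \<open>Y i\<close> for \<open>1 \<le> i \<le> m\<close>; nothing is assumed about other indices.
  The assumption \<open>indep\<close> is joint independence of the \<open>2 * m + 2\<close> variables consisting of the
  two starting points and all steps of both walks.
\<close>

locale two_simple_random_walks = prob_space M
  for M :: "'w measure" +
  fixes n m :: nat
    and a b :: "'w \<Rightarrow> int"
    and X Y :: "nat \<Rightarrow> 'w \<Rightarrow> int"
  assumes indep: "indep_vars (\<lambda>_. count_space UNIV) (walk_family a b X Y)
      ({Start_A, Start_B} \<union> Step_A ` {1..m} \<union> Step_B ` {1..m})"
    and start_a: "distr M (count_space UNIV) a = measure_pmf (pmf_of_set {1..int n})"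
    and start_b: "distr M (count_space UNIV) b = measure_pmf (pmf_of_set {1..int n})"
    and step_X: "\<And>i. i \<in> {1..m} \<Longrightarrow>
      distr M (count_space UNIV) (X i) = measure_pmf (pmf_of_set {- 1, 1})"
    and step_Y: "\<And>i. i \<in> {1..m} \<Longrightarrow>
      distr M (count_space UNIV) (Y i) = measure_pmf (pmf_of_set {- 1, 1})"

end

theory Submission imports Defs "HOL-Probability.Hoeffding" "HOL-Real_Asymp.Real_Asymp" begin

text \<open>
  Let \<open>D\<close> be the difference of the displacements of the two walks. The order of \<open>(A, B)\<close> can
  differ from that of \<open>(a, b)\<close> only if \<open>\<bar>a - b\<bar> \<le> t\<close> or \<open>\<bar>D\<bar> \<ge> t\<close>. For \<open>t = n powr (1 - \<epsilon> / 2)\<close>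
  the first event has probability at most \<open>(2 * t + 1) / n\<close> and the second one, by concentration,
  probability \<open>O(g n / t\<^sup>2) = O(n powr (- \<epsilon>))\<close>. Both tend to 0, while \<open>P(a < b)\<close> is bounded
  away from 0.
\<close>

context two_simple_random_walks
begin

section \<open>Measurability of starts and steps\<close>

lemma measurable_starts [measurable]:
  "a \<in> measurable M (count_space UNIV)" "b \<in> measurable M (count_space UNIV)"
  using indep unfolding indep_vars_def by force+

lemma measurable_steps:
  assumes "i \<in> {1..m}"
  shows "X i \<in> measurable M (count_space UNIV)" "Y i \<in> measurable M (count_space UNIV)"
proof -
  have "random_variable (count_space UNIV) (walk_family a b X Y j)"
    if "j \<in> {Step_A i, Step_B i}" for j
    using indep that assms unfolding indep_vars_def by blast
  from this[of "Step_A i"] this[of "Step_B i"]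
  show "X i \<in> measurable M (count_space UNIV)" "Y i \<in> measurable M (count_space UNIV)" by auto
qed

section \<open>Joint law of the two starting points\<close>

lemma indep_starts:
  "prob {\<omega> \<in> space M. a \<omega> \<in> S \<and> b \<omega> \<in> T}
    = prob {\<omega> \<in> space M. a \<omega> \<in> S} * prob {\<omega> \<in> space M. b \<omega> \<in> T}"
proof -
  let ?S = "case_walk_index S T (\<lambda>_. UNIV) (\<lambda>_. UNIV)"
  have "prob (\<Inter>j\<in>{Start_A, Start_B}. walk_family a b X Y j -` ?S j \<inter> space M)
      = (\<Prod>j\<in>{Start_A, Start_B}. prob (walk_family a b X Y j -` ?S j \<inter> space M))"
    by (rule indep_varsD[OF indep]) auto
  then show ?thesis
    by (simp add: vimage_def Int_def conj_commute conj_left_commute)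
qed

lemma prob_start:
  assumes "n \<ge> 1"
  shows "prob {\<omega> \<in> space M. a \<omega> \<in> S} = card ({1..int n} \<inter> S) / n"
    and "prob {\<omega> \<in> space M. b \<omega> \<in> S} = card ({1..int n} \<inter> S) / n"
proof -
  have "measure (measure_pmf (pmf_of_set {1..int n})) S = card ({1..int n} \<inter> S) / n"
    using assms by (subst measure_pmf_of_set) auto
  moreover have "prob {\<omega> \<in> space M. a \<omega> \<in> S} = measure (distr M (count_space UNIV) a) S"
    and "prob {\<omega> \<in> space M. b \<omega> \<in> S} = measure (distr M (count_space UNIV) b) S"
    by (auto simp: measure_distr vimage_def Int_def conj_commute)
  ultimately show "prob {\<omega> \<in> space M. a \<omega> \<in> S} = card ({1..int n} \<inter> S) / n"
    and "prob {\<omega> \<in> space M. b \<omega> \<in> S} = card ({1..int n} \<inter> S) / n"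
    by (simp_all add: start_a start_b)
qed

text \<open>Fix the value \<open>k\<close> of \<open>a\<close>. By independence \<open>b\<close> is
  still uniform, and it must hit one of at most \<open>2 * t + 1\<close> integers within distance
  \<open>t\<close> of \<open>k\<close>. Summing over the \<open>n\<close> values of
  \<open>k\<close>, each of weight \<open>1 / n\<close>, preserves the bound.\<close>

lemma prob_starts_close_le:
  fixes t :: real
  assumes "n \<ge> 1" "t \<ge> 0"
  shows "prob {\<omega> \<in> space M. \<bar>real_of_int (a \<omega>) - real_of_int (b \<omega>)\<bar> \<le> t} \<le> (2 * t + 1) / n"
proof -
  define near where "near k = {i::int. \<bar>real_of_int k - real_of_int i\<bar> \<le> t}" for k
  have near_eq: "near k = {k - \<lfloor>t\<rfloor>..k + \<lfloor>t\<rfloor>}" for k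
    unfolding near_def by (auto simp: abs_le_iff) linarith+
  have card_near: "real (card ({1..int n} \<inter> near k)) \<le> 2 * t + 1" for k
  proof -
    have "card ({1..int n} \<inter> near k) \<le> card (near k)"
      unfolding near_eq by (intro card_mono) auto
    \<comment> \<open>\<open>t \<ge> 0\<close> keeps the count
      \<open>2 * \<lfloor>t\<rfloor> + 1\<close> positive, so no truncation occurs in the
      cardinality.\<close>
    also have "real (card (near k)) = 2 * real_of_int \<lfloor>t\<rfloor> + 1"
      unfolding near_eq using assms by simp
    finally show ?thesis by (simp add: floor_le_iff) linarith
  qed
  let ?E = "\<lambda>k. {\<omega> \<in> space M. a \<omega> \<in> {k} \<and> b \<omega> \<in> near k}"
  \<comment> \<open>\<open>a\<close> lies in \<open>{1..int n}\<close> only almost surely; this null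
    event collects the other outcomes and leaves a finite union over \<open>k\<close>.\<close>
  have out: "prob {\<omega> \<in> space M. a \<omega> \<in> - {1..int n}} = 0"
    using assms by (subst prob_start) auto
  have "prob {\<omega> \<in> space M. \<bar>real_of_int (a \<omega>) - real_of_int (b \<omega>)\<bar> \<le> t}
      \<le> prob ((\<Union>k\<in>{1..int n}. ?E k) \<union> {\<omega> \<in> space M. a \<omega> \<in> - {1..int n}})"
    by (intro finite_measure_mono) (auto simp: near_def)
  also have "\<dots> \<le> prob (\<Union>k\<in>{1..int n}. ?E k) + prob {\<omega> \<in> space M. a \<omega> \<in> - {1..int n}}"
    by (intro measure_Un_le) auto
  also have "\<dots> \<le> (\<Sum>k\<in>{1..int n}. prob (?E k))"
    unfolding out by (simp, intro measure_UNION_le) auto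
  also have "\<dots> \<le> (\<Sum>k\<in>{1..int n}. 1 / n * ((2 * t + 1) / n))"
  proof (intro sum_mono)
    fix k assume "k \<in> {1..int n}"
    then have "prob (?E k) = 1 / n * (card ({1..int n} \<inter> near k) / n)"
      using assms(1) by (simp only: indep_starts prob_start) simp
    also have "\<dots> \<le> 1 / n * ((2 * t + 1) / n)"
      by (intro mult_left_mono divide_right_mono card_near) auto
    finally show "prob (?E k) \<le> 1 / n * ((2 * t + 1) / n)" .
  qed
  also have "\<dots> = (2 * t + 1) / n" using assms by simp
  finally show ?thesis .
qed

text \<open>Cut the range at its middle \<open>h\<close>: the event \<open>a \<le> h < b\<close>
  forces \<open>a < b\<close> and factors by independence. The limit argument only needs some
  positive constant here.\<close>

lemma prob_start_less_ge:
  assumes "n \<ge> 2"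
  shows "prob {\<omega> \<in> space M. a \<omega> < b \<omega>} \<ge> 1 / 6"
proof -
  define h where "h = int n div 2"
  \<comment> \<open>Rounding down makes \<open>h / n\<close> smallest at \<open>n = 3\<close>, where
    it is 1/3, and keeps \<open>(n - h) / n\<close> at least 1/2.\<close>
  have h: "3 * h \<ge> int n" "2 * h \<le> int n" "h \<ge> 0" using assms unfolding h_def by linarith+
  have "{1..int n} \<inter> {..h} = {1..h}" "{1..int n} \<inter> {h<..} = {h<..int n}"
    using h by auto
  then have "prob {\<omega> \<in> space M. a \<omega> \<in> {..h}} * prob {\<omega> \<in> space M. b \<omega> \<in> {h<..}}
      = (h / n) * ((int n - h) / n)"
    using assms h by (simp only: prob_start) simp
  moreover have "(h / n) * ((int n - h) / n) \<ge> (1 / 3) * (1 / 2)"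
    using assms h by (intro mult_mono) (auto simp: field_simps)
  moreover have "prob {\<omega> \<in> space M. a \<omega> \<in> {..h} \<and> b \<omega> \<in> {h<..}}
      \<le> prob {\<omega> \<in> space M. a \<omega> < b \<omega>}"
    by (intro finite_measure_mono) auto
  ultimately show ?thesis unfolding indep_starts by linarith
qed

section \<open>Concentration of the difference of the displacements\<close>

definition displacement_diff :: "'w \<Rightarrow> real" where
  "displacement_diff \<omega> = (\<Sum>i=1..m. real_of_int (X i \<omega>)) - (\<Sum>i=1..m. real_of_int (Y i \<omega>))"

lemma measurable_displacement_diff [measurable]: "displacement_diff \<in> borel_measurable M"
proof -
  have "(\<lambda>\<omega>. real_of_int (X i \<omega>)) \<in> borel_measurable M"
       "(\<lambda>\<omega>. real_of_int (Y i \<omega>)) \<in> borel_measurable M" if "i \<in> {1..m}" for i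
    using measurable_steps[OF that] by (auto intro: measurable_compose)
  then show ?thesis
    unfolding displacement_diff_def[abs_def] by (intro borel_measurable_diff borel_measurable_sum)
qed

lemma endpoint_less_iff:
  "walk_endpoint a X m \<omega> < walk_endpoint b Y m \<omega> \<longleftrightarrow>
    displacement_diff \<omega> < real_of_int (b \<omega>) - real_of_int (a \<omega>)"
proof -
  have "walk_endpoint a X m \<omega> < walk_endpoint b Y m \<omega> \<longleftrightarrow>
      real_of_int (walk_endpoint a X m \<omega>) < real_of_int (walk_endpoint b Y m \<omega>)"
    by simp
  then show ?thesis
    unfolding walk_endpoint_def displacement_diff_def by auto
qed

text \<open>Supplies the boundedness and the zero mean for Hoeffding's inequality, for the steps of
  either walk.\<close>

lemma step_bounded_centered:
  assumes "Z \<in> measurable M (count_space UNIV)"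
    and "distr M (count_space UNIV) Z = measure_pmf (pmf_of_set {- 1, 1 :: int})"
  shows "AE \<omega> in M. Z \<omega> \<in> {- 1, 1}" "expectation (\<lambda>\<omega>. real_of_int (Z \<omega>)) = 0"
proof -
  have "AE z in distr M (count_space UNIV) Z. z \<in> {- 1, 1}"
    unfolding assms(2) by (simp add: AE_measure_pmf_iff)
  then show "AE \<omega> in M. Z \<omega> \<in> {- 1, 1}"
    using assms(1) by (subst (asm) AE_distr_iff) auto
  have "expectation (\<lambda>\<omega>. real_of_int (Z \<omega>)) = (\<integral>z. real_of_int z \<partial>distr M (count_space UNIV) Z)"
    using assms(1) by (subst integral_distr) auto
  also have "\<dots> = 0"
    unfolding assms(2) by (subst integral_pmf_of_set) auto
  finally show "expectation (\<lambda>\<omega>. real_of_int (Z \<omega>)) = 0" .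
qed

text \<open>Hoeffding's inequality applies to the \<open>2 * m\<close> independent variables
  \<open>X i\<close> and \<open>- Y i\<close>; its exponential tail is then weakened to a quadratic
  one.\<close>

lemma prob_displacement_diff_ge:
  assumes "t > 0"
  shows "prob {\<omega> \<in> space M. t \<le> \<bar>displacement_diff \<omega>\<bar>} \<le> 8 * m / t\<^sup>2"
\<comment> \<open>Hoeffding's bound divides by the sum of squared ranges, which vanishes for
  \<open>m = 0\<close>.\<close>
proof (cases "m = 0")
  case True
  then have "displacement_diff \<omega> = 0" for \<omega> unfolding displacement_diff_def by simp
  then show ?thesis using assms by simp
next
  case False
  define I where "I = Step_A ` {1..m} \<union> Step_B ` {1..m}"
  \<comment> \<open>The sign turns the difference of two sums into one sum over
    \<open>I\<close>.\<close>
  define sg where "sg = (\<lambda>j. case j of Step_B _ \<Rightarrow> (- 1 :: real) | _ \<Rightarrow> 1)"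
  define Z where "Z = (\<lambda>j \<omega>. sg j * real_of_int (walk_family a b X Y j \<omega>))"
  have sum_I: "sum f I = (\<Sum>i=1..m. f (Step_A i)) + (\<Sum>i=1..m. f (Step_B i))" for f :: "_ \<Rightarrow> real"
    unfolding I_def by (subst sum.union_disjoint) (auto simp: sum.reindex inj_on_def)
  have sum_Z: "(\<Sum>j\<in>I. Z j \<omega>) = displacement_diff \<omega>" for \<omega>
    unfolding sum_I by (simp add: Z_def sg_def displacement_diff_def sum_negf)
  have family: "walk_family a b X Y j \<in> measurable M (count_space UNIV)"
    "distr M (count_space UNIV) (walk_family a b X Y j) = measure_pmf (pmf_of_set {- 1, 1})"
    if "j \<in> I" for j
    using that measurable_steps step_X step_Y by (auto simp: I_def)
  have "indep_vars (\<lambda>_. borel) Z I"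
    unfolding Z_def by (rule indep_vars_compose2[OF indep_vars_subset[OF indep]]) (auto simp: I_def)
  moreover have "AE \<omega> in M. Z j \<omega> \<in> {- 1..1}" if "j \<in> I" for j
    using step_bounded_centered(1)[OF family[OF that]]
    by eventually_elim (auto simp: Z_def sg_def split: walk_index.splits)
  moreover have "finite I" by (simp add: I_def)
  ultimately interpret Hoeffding_ineq M I Z "\<lambda>_. - 1" "\<lambda>_. 1" "\<Sum>j\<in>I. expectation (Z j)"
    by unfold_locales auto
  have mean: "(\<Sum>j\<in>I. expectation (Z j)) = 0"
    using step_bounded_centered(2)[OF family] by (simp add: Z_def)
  \<comment> \<open>Each of the \<open>2 * m\<close> variables ranges over an interval of length
    2.\<close>
  have range: "(\<Sum>j\<in>I. (1 - (- 1))\<^sup>2) = 8 * real m"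
    unfolding sum_I by simp
  have "prob {\<omega> \<in> space M. t \<le> \<bar>displacement_diff \<omega>\<bar>} \<le> 2 * exp (- 2 * t\<^sup>2 / (8 * m))"
    using Hoeffding_ineq_abs_ge[of t] assms False unfolding mean range sum_Z by simp
  also have "\<dots> = 2 / exp (t\<^sup>2 / (4 * m))"
    by (simp add: exp_minus field_simps)
  also have "\<dots> \<le> 2 / (t\<^sup>2 / (4 * m))"
  proof (rule divide_left_mono)
    show "t\<^sup>2 / (4 * m) \<le> exp (t\<^sup>2 / (4 * m))"
      using exp_ge_add_one_self[of "t\<^sup>2 / (4 * m)"] by linarith
  qed (use assms False in auto)
  finally show ?thesis by simp
qed

section \<open>The conditional probability for fixed \<open>n\<close>\<close>

lemma cond_prob_start_less_ge:
  fixes t :: real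
  assumes "n \<ge> 2" "t > 0" and q: "8 * m / t\<^sup>2 + (2 * t + 1) / n \<le> q" "q < 1 / 6"
  shows "\<P>(\<omega> in M. a \<omega> < b \<omega> \<bar> walk_endpoint a X m \<omega> < walk_endpoint b Y m \<omega>) \<ge> 1 - q / (1 / 6 - q)"
proof -
  \<comment> \<open>Off \<open>?bad\<close> the difference of the displacements is smaller in
    absolute value than \<open>t\<close>, and \<open>\<bar>a - b\<bar>\<close> exceeds
    \<open>t\<close>, so \<open>?after\<close> holds exactly when \<open>a < b\<close>. Hence these
    two events differ only inside \<open>?bad\<close>.\<close>
  let ?bad = "{\<omega> \<in> space M. t \<le> \<bar>displacement_diff \<omega>\<bar>} \<union>
    {\<omega> \<in> space M. \<bar>real_of_int (a \<omega>) - real_of_int (b \<omega>)\<bar> \<le> t}"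
  let ?after = "{\<omega> \<in> space M. displacement_diff \<omega> < real_of_int (b \<omega>) - real_of_int (a \<omega>)}"
  let ?both = "{\<omega> \<in> space M. a \<omega> < b \<omega> \<and> displacement_diff \<omega> < real_of_int (b \<omega>) - real_of_int (a \<omega>)}"
  have bad: "prob ?bad \<le> q"
  proof -
    have "prob ?bad \<le> prob {\<omega> \<in> space M. t \<le> \<bar>displacement_diff \<omega>\<bar>} +
        prob {\<omega> \<in> space M. \<bar>real_of_int (a \<omega>) - real_of_int (b \<omega>)\<bar> \<le> t}"
      by (intro measure_Un_le) auto
    then show ?thesis
      using prob_displacement_diff_ge[of t] prob_starts_close_le[of t] assms by auto
  qed
  have "prob {\<omega> \<in> space M. a \<omega> < b \<omega>} \<le> prob (?after \<union> ?bad)"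
    by (intro finite_measure_mono) auto
  also have "\<dots> \<le> prob ?after + prob ?bad"
    by (intro measure_Un_le) auto
  finally have after: "prob ?after \<ge> 1 / 6 - q"
    using prob_start_less_ge assms(1) bad by linarith
  have "prob ?after \<le> prob (?both \<union> ?bad)"
    by (intro finite_measure_mono) auto
  also have "\<dots> \<le> prob ?both + prob ?bad"
    by (intro measure_Un_le) auto
  finally have both: "prob ?both \<ge> prob ?after - q"
    using bad by linarith
  \<comment> \<open>Nonnegativity of \<open>q\<close> allows replacing the denominator by its
    positive lower bound \<open>1 / 6 - q\<close>.\<close>
  have "0 \<le> q" using bad measure_nonneg[of M ?bad] by linarith
  then have "q / prob ?after \<le> q / (1 / 6 - q)"
    using after q by (intro divide_left_mono mult_pos_pos) auto
  then have "1 - q / (1 / 6 - q) \<le> (prob ?after - q) / prob ?after"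
    using after q by (simp add: diff_divide_distrib)
  also have "\<dots> \<le> prob ?both / prob ?after"
    using both by (intro divide_right_mono) auto
  finally show ?thesis
    unfolding cond_prob_def endpoint_less_iff .
qed

text \<open>If the conditioning event is null, the quotient is 0 by the convention for division by
  zero, so the bound persists.\<close>

lemma cond_prob_start_less_le_1:
  "\<P>(\<omega> in M. a \<omega> < b \<omega> \<bar> walk_endpoint a X m \<omega> < walk_endpoint b Y m \<omega>) \<le> 1"
  unfolding cond_prob_def endpoint_less_iff
  by (intro divide_le_eq_1[THEN iffD2]) (auto simp: zero_less_measure_iff intro!: finite_measure_mono)

end

section \<open>The limit as \<open>n\<close> tends to infinity\<close>

theorem mainTheorem1:
  fixes \<epsilon> :: real
    and g :: "nat \<Rightarrow> nat"
    and M :: "nat \<Rightarrow> 'w measure"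
    and a b A B :: "nat \<Rightarrow> 'w \<Rightarrow> int"
    and X Y :: "nat \<Rightarrow> nat \<Rightarrow> 'w \<Rightarrow> int"
  assumes "\<epsilon> > 0"
    and "(\<lambda>n. real (g n)) \<in> O(\<lambda>n. real n powr (2 - 2 * \<epsilon>))"
    and "\<And>n. n \<ge> 2 \<Longrightarrow> two_simple_random_walks (M n) n (g n) (a n) (b n) (X n) (Y n)"
    and "\<And>n. n \<ge> 2 \<Longrightarrow> A n = walk_endpoint (a n) (X n) (g n)"
    and "\<And>n. n \<ge> 2 \<Longrightarrow> B n = walk_endpoint (b n) (Y n) (g n)"
  shows "(\<lambda>n. \<P>(\<omega> in M n. a n \<omega> < b n \<omega> \<bar> A n \<omega> < B n \<omega>)) \<longlonglongrightarrow> 1"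
proof -
  obtain C where C: "C > 0"
      "\<forall>\<^sub>F n in sequentially. norm (real (g n)) \<le> C * norm (real n powr (2 - 2 * \<epsilon>))"
    using assms(2) by (elim landau_o.bigE)
  \<comment> \<open>This is \<open>8 * g n / t\<^sup>2 + (2 * t + 1) / n\<close> at
    \<open>t = n powr (1 - \<epsilon> / 2)\<close>, with \<open>g n\<close> replaced by its bound
    \<open>C * n powr (2 - 2 * \<epsilon>)\<close>.\<close>
  define q where "q n = 8 * C * real n powr (- \<epsilon>) + 2 * real n powr (- \<epsilon> / 2) + 1 / real n" for n :: nat
  have "(\<lambda>n. 8 * C * real n powr (- \<epsilon>)) \<longlonglongrightarrow> 0" "(\<lambda>n. 2 * real n powr (- \<epsilon> / 2)) \<longlonglongrightarrow> 0"
      "(\<lambda>n. 1 / real n) \<longlonglongrightarrow> 0"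
    using assms(1) C(1) by real_asymp+
  then have q: "q \<longlonglongrightarrow> 0"
    unfolding q_def[abs_def] by (intro tendsto_add_zero)
  have lim: "(\<lambda>n. 1 - q n / (1 / 6 - q n)) \<longlonglongrightarrow> 1"
    by (rule tendsto_eq_intros q refl | simp)+
  have q_small: "\<forall>\<^sub>F n in sequentially. q n < 1 / 6"
    using q by (rule order_tendstoD) simp
  show ?thesis
  proof (rule tendsto_sandwich[OF _ _ lim tendsto_const])
    show "\<forall>\<^sub>F n in sequentially.
        1 - q n / (1 / 6 - q n) \<le> \<P>(\<omega> in M n. a n \<omega> < b n \<omega> \<bar> A n \<omega> < B n \<omega>)"
      using C(2) q_small eventually_ge_at_top[of 2]
    proof eventually_elim
      case (elim n)
      interpret two_simple_random_walks "M n" n "g n" "a n" "b n" "X n" "Y n"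
        by (rule assms(3)) (use elim in simp)
      \<comment> \<open>The exponent lies strictly between \<open>1 - \<epsilon>\<close>, which
        bounds the order of the typical displacement, and \<open>1\<close>, the order of the range
        of the starts.\<close>
      define t where "t = real n powr (1 - \<epsilon> / 2)"
      have t: "t > 0" using elim by (simp add: t_def)
      have "t\<^sup>2 = real n powr (2 - \<epsilon>)"
        using elim by (simp add: t_def power2_eq_square powr_add[symmetric])
      then have "8 * real (g n) / t\<^sup>2 \<le> 8 * (C * real n powr (2 - 2 * \<epsilon>)) / real n powr (2 - \<epsilon>)"
        using elim by (simp add: divide_right_mono)
      also have "\<dots> = 8 * C * real n powr (- \<epsilon>)"
      proof -
        have "real n powr (2 - 2 * \<epsilon>) = real n powr (2 - \<epsilon>) * real n powr (- \<epsilon>)"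
          by (simp add: powr_add[symmetric])
        then show ?thesis using elim by simp
      qed
      finally have "8 * real (g n) / t\<^sup>2 \<le> 8 * C * real n powr (- \<epsilon>)" .
      moreover have "t = real n * real n powr (- \<epsilon> / 2)"
        using elim powr_add[of "real n" 1 "- \<epsilon> / 2"] by (simp add: t_def)
      ultimately have "8 * real (g n) / t\<^sup>2 + (2 * t + 1) / real n \<le> q n"
        using elim by (simp add: q_def add_divide_distrib)
      then show ?case
        using cond_prob_start_less_ge[of t "q n"] elim t by (simp add: assms(4,5))
    qed
    show "\<forall>\<^sub>F n in sequentially. \<P>(\<omega> in M n. a n \<omega> < b n \<omega> \<bar> A n \<omega> < B n \<omega>) \<le> 1"
      using eventually_ge_at_top[of 2]
    proof eventually_elim
      case (elim n)
      interpret two_simple_random_walks "M n" n "g n" "a n" "b n" "X n" "Y n"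
        by (rule assms(3)) (use elim in simp)
      show ?case using cond_prob_start_less_le_1 elim by (simp add: assms(4,5))
    qed
  qed
qed

end
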